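(* Let $X,Y,Z$ be real normed linear spaces of dimension strictly greater than one. If $\mathcal{T}\in\mathscr{B}(X\times Y,Z)$ is a smooth point of $\mathscr{B}(X\times Y,Z)$ and $M_{\mathcal{T}}\neq\emptyset$, then there exists $(x_0,y_0)\in S_X\times S_Y$ such that $M_{\mathcal{T}}=\{(\pm x_0,\pm y_0)\}$.
   Context: $S_X$ denotes the unit sphere of $X$. $\mathscr{B}(X\times Y,Z)$ is the space of bounded bilinear operators $\mathcal{T}:X\times Y\to Z$ with norm $\|\mathcal{T}\|=\sup\{\|\mathcal{T}(x,y)\|:(x,y)\in S_X\times S_Y\}$, and $M_{\mathcal{T}}=\{(x,y)\in S_X\times S_Y:\|\mathcal{T}(x,y)\|=\|\mathcal{T}\|\}$. A nonzero element $w$ of a normed space $W$ is a smooth point if there is exactly one $f\in W^*$ with $\|f\|=1$ and $f(w)=\|w\|$; equivalently, for all $y,z\in W$, $w\perp_B y$ and $w\perp_B z$ imply $w\perp_B(y+z)$, where $w\perp_B y$ means $\|w+\lambda y\|\geq\|w\|$ for all $\lambda\in\mathbb{R}$. The set $\{(\pm x_0,\pm y_0)\}$ consists of all four sign combinations. *)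

theory Defs
  imports "HOL-Analysis.Analysis"
begin

section \<open>The normed space of bounded bilinear operators\<close>

typedef (overloaded) ('a, 'b, 'c) bilin =
  "{f :: 'a::real_normed_vector \<Rightarrow> 'b::real_normed_vector \<Rightarrow> 'c::real_normed_vector. bounded_bilinear f}"
  morphisms bilin_apply Bilin
  by (rule exI[of _ "\<lambda>_ _. 0"]) (auto simp: bounded_bilinear_def intro: exI[of _ 0])

setup_lifting type_definition_bilin

text \<open>
  The element \<open>0\<close> matters only when one of the two factors is the zero space: its unit sphere is
  empty, and \<open>Sup {}\<close> is unspecified on the reals. Otherwise it does not change the supremum, all
  elements being nonnegative; see \<open>norm_bilin_eq_SUP\<close> below.
\<close>

definition bilin_norm ::
  "('a::real_normed_vector \<Rightarrow> 'b::real_normed_vector \<Rightarrow> 'c::real_normed_vector) \<Rightarrow> real"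
  where "bilin_norm f = Sup (insert 0 {norm (f x y) | x y. x \<in> sphere 0 1 \<and> y \<in> sphere 0 1})"

lemma bilin_norm_bdd_above:
  assumes "bounded_bilinear f"
  shows "bdd_above {norm (f x y) | x y. x \<in> sphere 0 1 \<and> y \<in> sphere 0 1}"
proof -
  obtain K where K: "\<And>x y. norm (f x y) \<le> norm x * norm y * K"
    using assms by (auto simp: bounded_bilinear_def)
  show ?thesis
    by (rule bdd_aboveI[of _ K]) (clarsimp, metis K mult_1)
qed

lemma bilin_norm_upper:
  assumes "bounded_bilinear f" "norm x = 1" "norm y = 1"
  shows "norm (f x y) \<le> bilin_norm f"
  unfolding bilin_norm_def
  by (rule cSup_upper) (use assms bilin_norm_bdd_above[OF assms(1)] in auto)

lemma bilin_norm_nonneg: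
  assumes "bounded_bilinear f"
  shows "0 \<le> bilin_norm f"
  unfolding bilin_norm_def
  by (rule cSup_upper) (use bilin_norm_bdd_above[OF assms] in auto)

lemma bilin_norm_least:
  assumes "0 \<le> b" "\<And>x y. norm x = 1 \<Longrightarrow> norm y = 1 \<Longrightarrow> norm (f x y) \<le> b"
  shows "bilin_norm f \<le> b"
  unfolding bilin_norm_def
  by (rule cSup_least) (use assms in auto)

lemma bilin_norm_bound:
  assumes "bounded_bilinear f"
  shows "norm (f x y) \<le> bilin_norm f * norm x * norm y"
proof (cases "x = 0 \<or> y = 0")
  case True
  then show ?thesis
    using bounded_bilinear.zero_left[OF assms] bounded_bilinear.zero_right[OF assms] by auto
next
  case False
  have "norm (f (x /\<^sub>R norm x) (y /\<^sub>R norm y)) \<le> bilin_norm f"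
    by (rule bilin_norm_upper) (use assms False in auto)
  then have "norm (f x y) / (norm x * norm y) \<le> bilin_norm f"
    by (simp add: bounded_bilinear.scaleR_left[OF assms] bounded_bilinear.scaleR_right[OF assms]
        divide_simps mult.commute)
  then show ?thesis
    using False by (simp add: divide_simps mult.assoc)
qed

lemma bounded_bilinear_minus_op: "bounded_bilinear f \<Longrightarrow> bounded_bilinear (\<lambda>x y. - f x y)"
  by (simp add: bounded_bilinear_def)

lemma bounded_bilinear_scaleR_op:
  assumes "bounded_bilinear f"
  shows "bounded_bilinear (\<lambda>x y. r *\<^sub>R f x y)"
proof -
  obtain K where K: "\<And>x y. norm (f x y) \<le> norm x * norm y * K"
    using assms by (auto simp: bounded_bilinear_def)
  have "norm (r *\<^sub>R f x y) \<le> norm x * norm y * (\<bar>r\<bar> * K)" for x y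
    using mult_left_mono[OF K[of x y], of "\<bar>r\<bar>"] by (simp add: ac_simps)
  then have "\<exists>K. \<forall>x y. norm (r *\<^sub>R f x y) \<le> norm x * norm y * K"
    by blast
  then show ?thesis
    using assms unfolding bounded_bilinear_def by (simp add: scaleR_add_right scaleR_left_commute)
qed

lemma bounded_bilinear_add_op:
  assumes "bounded_bilinear f" "bounded_bilinear g"
  shows "bounded_bilinear (\<lambda>x y. f x y + g x y)"
proof -
  obtain K L where K: "\<And>x y. norm (f x y) \<le> norm x * norm y * K"
    and L: "\<And>x y. norm (g x y) \<le> norm x * norm y * L"
    using assms unfolding bounded_bilinear_def by metis
  have "norm (f x y + g x y) \<le> norm x * norm y * (K + L)" for x y
    using norm_triangle_ineq[of "f x y" "g x y"] K[of x y] L[of x y]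
    by (simp add: algebra_simps)
  then have "\<exists>K. \<forall>x y. norm (f x y + g x y) \<le> norm x * norm y * K"
    by blast
  then show ?thesis
    using assms unfolding bounded_bilinear_def by (simp add: scaleR_add_right add_ac)
qed

lemma bounded_bilinear_diff_op:
  assumes "bounded_bilinear f" "bounded_bilinear g"
  shows "bounded_bilinear (\<lambda>x y. f x y - g x y)"
  using bounded_bilinear_add_op[OF assms(1) bounded_bilinear_minus_op[OF assms(2)]] by simp

lemma bounded_bilinear_zero_op: "bounded_bilinear (\<lambda>x y. 0)"
  by (auto simp: bounded_bilinear_def intro: exI[of _ 0])

lemma bilin_norm_eq_0:
  assumes "bounded_bilinear f"
  shows "bilin_norm f = 0 \<longleftrightarrow> f = (\<lambda>x y. 0)"
proof
  assume "bilin_norm f = 0"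
  then show "f = (\<lambda>x y. 0)"
    using bilin_norm_bound[OF assms] by (intro ext) simp
next
  assume "f = (\<lambda>x y. 0)"
  then show "bilin_norm f = 0"
    using bilin_norm_nonneg[OF assms] bilin_norm_least[of 0 f] by auto
qed

lemma bilin_norm_triangle:
  assumes "bounded_bilinear f" "bounded_bilinear g"
  shows "bilin_norm (\<lambda>x y. f x y + g x y) \<le> bilin_norm f + bilin_norm g"
proof (rule bilin_norm_least)
  show "0 \<le> bilin_norm f + bilin_norm g"
    using assms by (simp add: bilin_norm_nonneg)
  show "norm (f x y + g x y) \<le> bilin_norm f + bilin_norm g" if "norm x = 1" "norm y = 1" for x y
    using bilin_norm_upper[OF assms(1) that] bilin_norm_upper[OF assms(2) that]
      norm_triangle_ineq[of "f x y" "g x y"] by linarith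
qed

lemma bilin_norm_scaleR_le:
  assumes "bounded_bilinear f"
  shows "bilin_norm (\<lambda>x y. r *\<^sub>R f x y) \<le> \<bar>r\<bar> * bilin_norm f"
  by (rule bilin_norm_least)
    (use assms in \<open>auto simp: bilin_norm_nonneg intro!: mult_left_mono bilin_norm_upper\<close>)

lemma bilin_norm_scaleR:
  assumes "bounded_bilinear f"
  shows "bilin_norm (\<lambda>x y. r *\<^sub>R f x y) = \<bar>r\<bar> * bilin_norm f"
proof (cases "r = 0")
  case True
  then show ?thesis
    using bilin_norm_eq_0[OF bounded_bilinear_zero_op] by simp
next
  case False
  have "bilin_norm f \<le> \<bar>inverse r\<bar> * bilin_norm (\<lambda>x y. r *\<^sub>R f x y)"
    using bilin_norm_scaleR_le[OF bounded_bilinear_scaleR_op[OF assms], of "inverse r" r] False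
    by simp
  then have "\<bar>r\<bar> * bilin_norm f \<le> bilin_norm (\<lambda>x y. r *\<^sub>R f x y)"
    using False by (simp add: field_simps)
  then show ?thesis
    using bilin_norm_scaleR_le[OF assms, of r] by simp
qed

instantiation bilin :: (real_normed_vector, real_normed_vector, real_normed_vector) real_normed_vector
begin

lift_definition norm_bilin :: "('a, 'b, 'c) bilin \<Rightarrow> real" is bilin_norm .

lift_definition zero_bilin :: "('a, 'b, 'c) bilin" is "\<lambda>x y. 0"
  by (rule bounded_bilinear_zero_op)

lift_definition plus_bilin :: "('a, 'b, 'c) bilin \<Rightarrow> ('a, 'b, 'c) bilin \<Rightarrow> ('a, 'b, 'c) bilin"
  is "\<lambda>f g x y. f x y + g x y"
  by (rule bounded_bilinear_add_op)

lift_definition minus_bilin :: "('a, 'b, 'c) bilin \<Rightarrow> ('a, 'b, 'c) bilin \<Rightarrow> ('a, 'b, 'c) bilin"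
  is "\<lambda>f g x y. f x y - g x y"
  by (rule bounded_bilinear_diff_op)

lift_definition uminus_bilin :: "('a, 'b, 'c) bilin \<Rightarrow> ('a, 'b, 'c) bilin"
  is "\<lambda>f x y. - f x y"
  by (rule bounded_bilinear_minus_op)

lift_definition scaleR_bilin :: "real \<Rightarrow> ('a, 'b, 'c) bilin \<Rightarrow> ('a, 'b, 'c) bilin"
  is "\<lambda>r f x y. r *\<^sub>R f x y"
  by (rule bounded_bilinear_scaleR_op)

definition dist_bilin :: "('a, 'b, 'c) bilin \<Rightarrow> ('a, 'b, 'c) bilin \<Rightarrow> real"
  where "dist_bilin S T = norm (S - T)"

definition uniformity_bilin :: "(('a, 'b, 'c) bilin \<times> ('a, 'b, 'c) bilin) filter"
  where "uniformity_bilin = (INF e\<in>{0 <..}. principal {(S, T). dist S T < e})"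

definition open_bilin :: "('a, 'b, 'c) bilin set \<Rightarrow> bool"
  where "open_bilin U = (\<forall>S\<in>U. \<forall>\<^sub>F (S', T) in uniformity. S' = S \<longrightarrow> T \<in> U)"

definition sgn_bilin :: "('a, 'b, 'c) bilin \<Rightarrow> ('a, 'b, 'c) bilin"
  where "sgn_bilin T = scaleR (inverse (norm T)) T"

instance
  apply standard
  unfolding dist_bilin_def open_bilin_def sgn_bilin_def uniformity_bilin_def
  apply (rule refl | (transfer, force simp: bilin_norm_triangle bilin_norm_scaleR bilin_norm_eq_0 algebra_simps))+
  done

end

lemma norm_bilin_eq_SUP:
  fixes T :: "('a::real_normed_vector, 'b::real_normed_vector, 'c::real_normed_vector) bilin"
  assumes "sphere (0::'a) 1 \<noteq> {}" "sphere (0::'b) 1 \<noteq> {}"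
  shows "norm T = (SUP (x, y) \<in> sphere 0 1 \<times> sphere 0 1. norm (bilin_apply T x y))"
proof -
  let ?A = "{norm (bilin_apply T x y) | x y. x \<in> sphere 0 1 \<and> y \<in> sphere 0 1}"
  have bdd: "bdd_above ?A"
    using bilin_apply[of T] by (intro bilin_norm_bdd_above) simp
  from assms obtain a where a: "a \<in> ?A" by blast
  then have "0 \<le> a" by auto
  with a bdd have "0 \<le> Sup ?A" by (meson cSup_upper order_trans)
  then have "Sup (insert 0 ?A) = Sup ?A"
    using a bdd by (subst cSup_insert) (auto simp: sup_real_def)
  moreover have "?A = (\<lambda>(x, y). norm (bilin_apply T x y)) ` (sphere 0 1 \<times> sphere 0 1)"
    by auto metis
  ultimately show ?thesis
    by (simp add: norm_bilin.rep_eq bilin_norm_def)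
qed


section \<open>Norm attainment, smoothness and dimension\<close>

definition norm_attainment_set ::
  "('a::real_normed_vector, 'b::real_normed_vector, 'c::real_normed_vector) bilin \<Rightarrow> ('a \<times> 'b) set"
  where "norm_attainment_set T =
    {(x, y). x \<in> sphere 0 1 \<and> y \<in> sphere 0 1 \<and> norm (bilin_apply T x y) = norm T}"

definition smooth_point :: "'w::real_normed_vector \<Rightarrow> bool"
  where "smooth_point w \<longleftrightarrow>
    w \<noteq> 0 \<and> (\<exists>!f :: 'w \<Rightarrow>\<^sub>L real. norm f = 1 \<and> blinfun_apply f w = norm w)"

text \<open>
  The library's \<open>dim\<close> is \<open>0\<close> on infinite-dimensional spaces, so that \<open>dim UNIV > 1\<close> would
  exclude them. Here the dimension is the cardinality of a Hamel basis, possibly infinite.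
\<close>

definition dim_gt_one :: "'a::real_vector itself \<Rightarrow> bool"
  where "dim_gt_one _ \<longleftrightarrow>
    (\<exists>B :: 'a set. independent B \<and> span B = UNIV \<and> (infinite B \<or> card B > 1))"

end

theory Submission
  imports Defs
begin

text \<open>
  Put \<open>x \<otimes> y \<otimes> \<phi>\<close> for the functional \<open>S \<mapsto> \<phi> (S (x, y))\<close> on the space of bilinear operators. If
  \<open>T\<close> attains its norm at \<open>(x, y)\<close> and \<open>\<phi>\<close> is a norm-one functional with \<open>\<phi> (T (x, y)) = \<parallel>T\<parallel>\<close>,
  which the Hahn--Banach theorem provides, then \<open>x \<otimes> y \<otimes> \<phi>\<close> supports the unit ball at \<open>T\<close>.
  At a smooth point there is only one support functional, so any two points of norm attainment
  give \<open>x \<otimes> y \<otimes> \<phi> = x' \<otimes> y' \<otimes> \<psi>\<close> (lemma \<open>evaluation_functionals_eq_if_smooth\<close>).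

  Such an equality of nonzero elementary tensors determines its factors up to scalars: evaluated at
  the operators \<open>(u, v) \<mapsto> f u * g v * z\<close> with \<open>g\<close> and \<open>z\<close> kept fixed it reads \<open>f x' = c * f x\<close>
  for all functionals \<open>f\<close>, hence \<open>x' = c * x\<close> because functionals separate points
  (lemma \<open>elementary_tensor_factors_parallel\<close>). As \<open>x\<close> and \<open>x'\<close> are unit vectors, \<open>x' = \<plusminus> x\<close>;
  likewise \<open>y' = \<plusminus> y\<close>. Conversely, sign changes do not affect the norm of \<open>T (x, y)\<close>.

  The Hahn--Banach theorem is used in the form that every vector has a norming functional. It is
  obtained by taking a minimal sublinear functional below a given one: minimality forces
  linearity (lemma \<open>minimal_sublinear_is_linear\<close>).
\<close>

section \<open>Norming functionals\<close>

text \<open>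
  The inequality in the second clause suffices, since applying it to \<open>c\<close> and \<open>1 / c\<close> gives equality
  for \<open>c > 0\<close>; it passes to infima more directly than the equality.
\<close>

definition sublinear :: "('a::real_vector \<Rightarrow> real) \<Rightarrow> bool"
  where "sublinear p \<longleftrightarrow>
    (\<forall>v w. p (v + w) \<le> p v + p w) \<and> (\<forall>c\<ge>0. \<forall>v. p (c *\<^sub>R v) \<le> c * p v)"

lemma sublinear_add: "sublinear p \<Longrightarrow> p (v + w) \<le> p v + p w"
  by (simp add: sublinear_def)

lemma sublinear_scaleR_le: "sublinear p \<Longrightarrow> 0 \<le> c \<Longrightarrow> p (c *\<^sub>R v) \<le> c * p v"
  by (simp add: sublinear_def)

lemma sublinear_zero:
  assumes "sublinear p"
  shows "p 0 = 0"
  using sublinear_scaleR_le[OF assms, of 0 0] sublinear_add[OF assms, of 0 0] by simp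

lemma sublinear_ge_neg:
  assumes "sublinear p"
  shows "- p (- v) \<le> p v"
  using sublinear_add[OF assms, of v "- v"] sublinear_zero[OF assms] by simp

lemma sublinear_scaleR:
  assumes "sublinear p" "0 \<le> c"
  shows "p (c *\<^sub>R v) = c * p v"
proof (cases "c = 0")
  case True
  then show ?thesis using sublinear_zero[OF assms(1)] by simp
next
  case False
  then have "p v \<le> inverse c * p (c *\<^sub>R v)"
    using sublinear_scaleR_le[OF assms(1), of "inverse c" "c *\<^sub>R v"] assms(2) by simp
  then have "c * p v \<le> p (c *\<^sub>R v)"
    using False assms(2) by (simp add: field_simps)
  then show ?thesis
    using sublinear_scaleR_le[OF assms, of v] by simp
qed

lemma sublinear_norm: "sublinear (norm :: 'a::real_normed_vector \<Rightarrow> real)"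
  by (simp add: sublinear_def norm_triangle_ineq)

text \<open>
  A sublinear functional can be lowered until it is odd in a prescribed direction \<open>x\<close>: the infimum
  of \<open>p (v + t *\<^sub>R x) - t * p x\<close> over \<open>t \<ge> 0\<close> is again sublinear, lies below \<open>p\<close> by \<open>t = 0\<close>, and
  at \<open>v = - x\<close>, \<open>t = 1\<close> it is at most \<open>- p x\<close>.
\<close>

lemma sublinear_lower_in_direction:
  fixes p :: "'a::real_vector \<Rightarrow> real"
  assumes p: "sublinear p"
  obtains q where "sublinear q" "\<And>v. q v \<le> p v" "q (- x) \<le> - p x"
proof -
  define h where "h v t = p (v + t *\<^sub>R x) - t * p x" for v t
  define q where "q v = (INF t\<in>{0..}. h v t)" for v
  have lower: "- p (- v) \<le> h v t" if "0 \<le> t" for v t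
    using sublinear_add[OF p, of "v + t *\<^sub>R x" "- v"] sublinear_scaleR[OF p that, of x]
    by (simp add: h_def)
  have bdd: "bdd_below (h v ` {0..})" for v
    using lower by (intro bdd_belowI[of _ "- p (- v)"]) auto
  have q_le: "q v \<le> h v t" if "0 \<le> t" for v t
    unfolding q_def using bdd that by (intro cINF_lower) auto
  have q_ge: "b \<le> q v" if "\<And>t. 0 \<le> t \<Longrightarrow> b \<le> h v t" for b v
    unfolding q_def using that by (intro cINF_greatest) auto
  have "q (v + w) \<le> q v + q w" for v w
  proof -
    have "q (v + w) \<le> h v t + h w s" if "0 \<le> t" "0 \<le> s" for t s
      using q_le[of "t + s" "v + w"] that
        sublinear_add[OF p, of "v + t *\<^sub>R x" "w + s *\<^sub>R x"]
      by (simp add: h_def algebra_simps)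
    then have "q (v + w) - h v t \<le> q w" if "0 \<le> t" for t
      using that by (intro q_ge) (simp add: algebra_simps)
    then have "q (v + w) - q w \<le> q v"
      by (intro q_ge) (simp add: algebra_simps)
    then show ?thesis by simp
  qed
  moreover have "q (c *\<^sub>R v) \<le> c * q v" if "0 \<le> c" for c v
  proof (cases "c = 0")
    case True
    then show ?thesis
      using q_le[of 0 0] sublinear_zero[OF p] by (simp add: h_def)
  next
    case False
    with that have c: "0 < c" by simp
    have "q (c *\<^sub>R v) / c \<le> h v t" if "0 \<le> t" for t
    proof -
      have "q (c *\<^sub>R v) \<le> h (c *\<^sub>R v) (c * t)"
        using q_le[of "c * t"] c that by simp
      also have "\<dots> = c * h v t"
        using sublinear_scaleR[OF p, of c "v + t *\<^sub>R x"] c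
        by (simp add: h_def algebra_simps)
      finally show ?thesis
        using c by (simp add: field_simps)
    qed
    then have "q (c *\<^sub>R v) / c \<le> q v"
      by (rule q_ge)
    then show ?thesis
      using c by (simp add: field_simps)
  qed
  ultimately have "sublinear q"
    by (simp add: sublinear_def)
  moreover have "q v \<le> p v" for v
    using q_le[of 0 v] by (simp add: h_def)
  moreover have "q (- x) \<le> - p x"
    using q_le[of 1 "- x"] sublinear_zero[OF p] by (simp add: h_def)
  ultimately show ?thesis
    by (rule that)
qed

text \<open>
  Minimality excludes a proper lowering in any direction, so the functional is odd. Oddness turns
  subadditivity into additivity and positive homogeneity into homogeneity.
\<close>

lemma minimal_sublinear_is_linear:
  fixes m :: "'a::real_vector \<Rightarrow> real"
  assumes m: "sublinear m"
    and minimal: "\<And>q. sublinear q \<Longrightarrow> (\<And>v. q v \<le> m v) \<Longrightarrow> q = m"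
  shows "linear m"
proof -
  have odd: "m (- v) = - m v" for v
  proof -
    obtain q where q: "sublinear q" "\<And>u. q u \<le> m u" "q (- v) \<le> - m v"
      using sublinear_lower_in_direction[OF m, of v] by blast
    have "q = m"
      using q by (intro minimal)
    with q(3) have "m (- v) \<le> - m v" by simp
    then show ?thesis
      using sublinear_ge_neg[OF m, of v] by simp
  qed
  show ?thesis
  proof (rule linearI)
    show "m (v + w) = m v + m w" for v w
      using sublinear_add[OF m, of v w] sublinear_add[OF m, of "- v" "- w"]
        odd[of v] odd[of w] odd[of "v + w"]
      by simp
    show "m (c *\<^sub>R v) = c *\<^sub>R m v" for c v
    proof (cases "0 \<le> c")
      case True
      then show ?thesis using sublinear_scaleR[OF m] by simp
    next
      case False
      then have "m ((- c) *\<^sub>R v) = (- c) * m v"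
        by (intro sublinear_scaleR[OF m]) simp
      then show ?thesis using odd[of "c *\<^sub>R v"] by simp
    qed
  qed
qed

text \<open>
  Zorn's lemma applies because every sublinear \<open>q \<le> p\<close> satisfies \<open>q v \<ge> - p (- v)\<close>, which keeps the
  pointwise infimum of a chain finite.
\<close>

lemma linear_below_sublinear:
  fixes p :: "'a::real_vector \<Rightarrow> real"
  assumes p: "sublinear p"
  obtains f where "linear f" "\<And>v. f v \<le> p v"
proof -
  define A where "A = {q. sublinear q \<and> q \<le> p}"
  have lower: "- p (- v) \<le> q v" if "q \<in> A" for q v
  proof -
    have "- q (- v) \<le> q v" "q (- v) \<le> p (- v)"
      using that sublinear_ge_neg[of q v] by (auto simp: A_def le_fun_def)
    then show ?thesis by linarith
  qed
  have "\<exists>m\<in>A. \<forall>q\<in>A. m \<ge> q \<longrightarrow> q = m"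
  proof (rule predicate_Zorn)
    show "partial_order_on A (relation_of (\<ge>) A)"
      by (rule partial_order_on_relation_ofI) auto
    fix C assume "C \<in> Chains (relation_of (\<ge>) A)"
    then have CA: "C \<subseteq> A" and chain: "\<And>q r. q \<in> C \<Longrightarrow> r \<in> C \<Longrightarrow> q \<le> r \<or> r \<le> q"
      by (auto simp: Chains_def relation_of_def)
    show "\<exists>u\<in>A. \<forall>q\<in>C. q \<ge> u"
    proof (cases "C = {}")
      case True
      then show ?thesis using p by (auto simp: A_def)
    next
      case False
      define u where "u v = (INF q\<in>C. q v)" for v
      have u_le: "u v \<le> q v" if "q \<in> C" for q v
        unfolding u_def using that CA lower
        by (intro cINF_lower bdd_belowI[of _ "- p (- v)"]) auto
      have u_ge: "b \<le> u v" if "\<And>q. q \<in> C \<Longrightarrow> b \<le> q v" for b v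
        unfolding u_def using that False by (intro cINF_greatest) auto
      have "u (v + w) \<le> u v + u w" for v w
      proof -
        have le_sum: "u (v + w) \<le> q v + r w" if qr: "q \<in> C" "r \<in> C" for q r
        proof -
          \<comment> \<open>Subadditivity of the smaller of \<open>q\<close> and \<open>r\<close> bounds the value at \<open>v + w\<close>.\<close>
          obtain s where s: "s \<in> C" "s \<le> q" "s \<le> r"
            using chain[OF qr] qr by blast
          have "u (v + w) \<le> s (v + w)"
            by (rule u_le) (rule s)
          also have "\<dots> \<le> s v + s w"
            using s CA by (intro sublinear_add) (auto simp: A_def)
          also have "\<dots> \<le> q v + r w"
            using s by (intro add_mono) (auto simp: le_fun_def)
          finally show ?thesis .
        qed
        have "u (v + w) - q v \<le> u w" if "q \<in> C" for q
          using le_sum[OF that] by (intro u_ge) (simp add: diff_le_eq add.commute)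
        then have "u (v + w) - u w \<le> u v"
          by (intro u_ge) (simp add: algebra_simps)
        then show ?thesis by simp
      qed
      moreover have "u (c *\<^sub>R v) \<le> c * u v" if c: "0 \<le> c" for c v
      proof (cases "c = 0")
        case True
        obtain q where "q \<in> C" using False by blast
        then have "u 0 \<le> 0"
          using u_le[of q 0] CA sublinear_zero[of q] by (auto simp: A_def)
        then show ?thesis using True by simp
      next
        case False
        with c have c: "0 < c" by simp
        have "u (c *\<^sub>R v) / c \<le> q v" if "q \<in> C" for q
        proof -
          have "u (c *\<^sub>R v) \<le> q (c *\<^sub>R v)"
            by (rule u_le) (rule that)
          also have "\<dots> \<le> c * q v"
            using that CA c by (intro sublinear_scaleR_le) (auto simp: A_def)
          finally show ?thesis
            using c by (simp add: field_simps)
        qed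
        then have "u (c *\<^sub>R v) / c \<le> u v"
          by (rule u_ge)
        then show ?thesis
          using c by (simp add: field_simps)
      qed
      ultimately have "sublinear u"
        by (simp add: sublinear_def)
      moreover have "u \<le> p"
      proof -
        obtain q where "q \<in> C" using False by blast
        then have "u \<le> q" "q \<le> p"
          using u_le CA by (auto simp: A_def le_fun_def)
        then show ?thesis by (rule order_trans)
      qed
      ultimately show ?thesis
        using u_le by (auto simp: A_def le_fun_def)
    qed
  qed
  then obtain m where m: "sublinear m" "m \<le> p" and min: "\<And>q. q \<in> A \<Longrightarrow> q \<le> m \<Longrightarrow> q = m"
    by (auto simp: A_def)
  have "linear m"
  proof (rule minimal_sublinear_is_linear[OF m(1)])
    fix q assume q: "sublinear q" "\<And>v. q v \<le> m v"
    then have "q \<le> m" by (simp add: le_fun_def)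
    moreover from this have "q \<in> A"
      using q(1) m(2) by (auto simp: A_def)
    ultimately show "q = m" by (intro min)
  qed
  then show ?thesis
    using that m(2) by (simp add: le_fun_def)
qed

text \<open>
  Lowering the norm in the direction \<open>x\<close> before passing to a linear functional below it forces the
  value at \<open>x\<close> to be as large as possible.
\<close>

theorem norming_functional_exists:
  fixes x :: "'a::real_normed_vector"
  obtains f :: "'a \<Rightarrow>\<^sub>L real" where "norm f \<le> 1" "blinfun_apply f x = norm x"
proof -
  obtain q where q: "sublinear q" "\<And>v. q v \<le> norm v" "q (- x) \<le> - norm x"
    using sublinear_lower_in_direction[OF sublinear_norm] by blast
  obtain f where f: "linear f" "\<And>v. f v \<le> q v"
    using linear_below_sublinear[OF q(1)] by blast
  have le: "f v \<le> norm v" for v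
    using f(2)[of v] q(2)[of v] by linarith
  have abs_le: "\<bar>f v\<bar> \<le> norm v" for v
    using le[of v] le[of "- v"] linear_neg[OF f(1), of v] by simp
  have bl: "bounded_linear f"
    using f(1) abs_le
    by (intro bounded_linear_intro[of f 1]) (auto simp: linear_add linear_scale)
  have "norm (Blinfun f) \<le> 1"
    using abs_le by (intro norm_blinfun_bound) (simp_all add: bounded_linear_Blinfun_apply[OF bl])
  moreover have "norm x \<le> f x"
    using f(2)[of "- x"] q(3) linear_neg[OF f(1), of x] by simp
  then have "blinfun_apply (Blinfun f) x = norm x"
    using le[of x] by (simp add: bounded_linear_Blinfun_apply[OF bl])
  ultimately show ?thesis
    by (rule that)
qed

lemma blinfun_real_separates:
  fixes x :: "'a::real_normed_vector"
  assumes "\<And>f :: 'a \<Rightarrow>\<^sub>L real. blinfun_apply f x = 0"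
  shows "x = 0"
proof -
  obtain f :: "'a \<Rightarrow>\<^sub>L real" where "blinfun_apply f x = norm x"
    using norming_functional_exists[of x] by blast
  then show ?thesis using assms[of f] by simp
qed


section \<open>Evaluation functionals on bilinear operators\<close>

lemma bounded_bilinear_bilin_apply: "bounded_bilinear (bilin_apply T)"
  using bilin_apply[of T] by simp

lemma norm_bilin_apply_le: "norm (bilin_apply T x y) \<le> norm T * norm x * norm y"
  using bilin_norm_bound[OF bounded_bilinear_bilin_apply, of T x y]
  by (simp add: norm_bilin.rep_eq)

definition evaluation_functional ::
  "'a::real_normed_vector \<Rightarrow> 'b::real_normed_vector \<Rightarrow> ('c::real_normed_vector \<Rightarrow>\<^sub>L real)
    \<Rightarrow> ('a, 'b, 'c) bilin \<Rightarrow>\<^sub>L real"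
  where "evaluation_functional x y \<phi> = Blinfun (\<lambda>S. blinfun_apply \<phi> (bilin_apply S x y))"

lemma abs_evaluation_le:
  "\<bar>blinfun_apply \<phi> (bilin_apply S x y)\<bar> \<le> norm S * (norm \<phi> * norm x * norm y)"
proof -
  have "\<bar>blinfun_apply \<phi> (bilin_apply S x y)\<bar> \<le> norm \<phi> * norm (bilin_apply S x y)"
    using norm_blinfun[of \<phi>] by simp
  also have "\<dots> \<le> norm \<phi> * (norm S * norm x * norm y)"
    by (intro mult_left_mono norm_bilin_apply_le) simp
  finally show ?thesis
    by (simp add: ac_simps)
qed

lemma evaluation_functional_apply:
  "blinfun_apply (evaluation_functional x y \<phi>) S = blinfun_apply \<phi> (bilin_apply S x y)"
proof -
  have "bounded_linear (\<lambda>S. blinfun_apply \<phi> (bilin_apply S x y))"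
    using abs_evaluation_le
    by (intro bounded_linear_intro[where K = "norm \<phi> * norm x * norm y"])
      (auto simp: plus_bilin.rep_eq scaleR_bilin.rep_eq blinfun.add_right blinfun.scaleR_right)
  then show ?thesis
    by (simp add: evaluation_functional_def bounded_linear_Blinfun_apply)
qed

lemma norm_evaluation_functional_le:
  "norm (evaluation_functional x y \<phi>) \<le> norm \<phi> * norm x * norm y"
proof (rule norm_blinfun_bound)
  show "norm (blinfun_apply (evaluation_functional x y \<phi>) S) \<le> norm \<phi> * norm x * norm y * norm S" for S
    using abs_evaluation_le[of \<phi> S x y] by (simp add: evaluation_functional_apply ac_simps)
qed simp

text \<open>
  The equality holds because both sides are support functionals at \<open>T\<close>: their norm is at most one,
  and at least one since they send \<open>T\<close> to \<open>\<parallel>T\<parallel>\<close>.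
\<close>

lemma evaluation_functionals_eq_if_smooth:
  fixes T :: "('a::real_normed_vector, 'b::real_normed_vector, 'c::real_normed_vector) bilin"
  assumes smooth: "smooth_point T"
    and "norm x = 1" "norm y = 1" "norm \<phi> \<le> 1" "blinfun_apply \<phi> (bilin_apply T x y) = norm T"
    and "norm x' = 1" "norm y' = 1" "norm \<psi> \<le> 1" "blinfun_apply \<psi> (bilin_apply T x' y') = norm T"
  shows "evaluation_functional x y \<phi> = evaluation_functional x' y' \<psi>"
proof -
  have T: "0 < norm T"
    and unique: "\<exists>!F :: ('a, 'b, 'c) bilin \<Rightarrow>\<^sub>L real. norm F = 1 \<and> blinfun_apply F T = norm T"
    using smooth by (auto simp: smooth_point_def)
  have support: "norm (evaluation_functional u v \<eta>) = 1
      \<and> blinfun_apply (evaluation_functional u v \<eta>) T = norm T"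
    if "norm u = 1" "norm v = 1" "norm \<eta> \<le> 1" "blinfun_apply \<eta> (bilin_apply T u v) = norm T"
    for u :: 'a and v :: 'b and \<eta> :: "'c \<Rightarrow>\<^sub>L real"
  proof -
    let ?F = "evaluation_functional u v \<eta>"
    have FT: "blinfun_apply ?F T = norm T"
      using that by (simp add: evaluation_functional_apply)
    have "norm ?F \<le> 1"
      using norm_evaluation_functional_le[of u v \<eta>] that by simp
    moreover have "norm T \<le> norm ?F * norm T"
      using norm_blinfun[of ?F T] FT by simp
    then have "1 \<le> norm ?F"
      using T by simp
    ultimately show ?thesis
      using FT by simp
  qed
  show ?thesis
    using unique support[of x y \<phi>] support[of x' y' \<psi>] assms by blast
qed

definition rank_one_bilin ::
  "('a::real_normed_vector \<Rightarrow>\<^sub>L real) \<Rightarrow> ('b::real_normed_vector \<Rightarrow>\<^sub>L real) \<Rightarrow> 'c::real_normed_vector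
    \<Rightarrow> ('a, 'b, 'c) bilin"
  where "rank_one_bilin f g z = Bilin (\<lambda>u v. (blinfun_apply f u * blinfun_apply g v) *\<^sub>R z)"

lemma rank_one_bilin_apply:
  "bilin_apply (rank_one_bilin f g z) u v = (blinfun_apply f u * blinfun_apply g v) *\<^sub>R z"
proof -
  have "bounded_bilinear (\<lambda>u v. (blinfun_apply f u * blinfun_apply g v) *\<^sub>R z)"
  proof
    have "norm ((blinfun_apply f u * blinfun_apply g v) *\<^sub>R z)
        \<le> norm u * norm v * (norm f * norm g * norm z)" for u v
    proof -
      have "\<bar>blinfun_apply f u\<bar> * \<bar>blinfun_apply g v\<bar> \<le> (norm f * norm u) * (norm g * norm v)"
        using norm_blinfun[of f u] norm_blinfun[of g v] by (intro mult_mono) auto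
      then have "(\<bar>blinfun_apply f u\<bar> * \<bar>blinfun_apply g v\<bar>) * norm z
          \<le> ((norm f * norm u) * (norm g * norm v)) * norm z"
        by (rule mult_right_mono) simp
      then show ?thesis
        by (simp add: abs_mult ac_simps)
    qed
    then show "\<exists>K. \<forall>u v. norm ((blinfun_apply f u * blinfun_apply g v) *\<^sub>R z) \<le> norm u * norm v * K"
      by blast
  qed (simp_all add: blinfun.add_right blinfun.scaleR_right algebra_simps)
  then show ?thesis
    by (simp add: rank_one_bilin_def Bilin_inverse)
qed

text \<open>
  Testing on operators of rank one with all but one factor fixed shows that functionals cannot
  distinguish \<open>x'\<close> from a fixed multiple of \<open>x\<close>, nor \<open>y'\<close> from a fixed multiple of \<open>y\<close>.
\<close>

lemma elementary_tensor_factors_parallel: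
  fixes \<phi> \<psi> :: "'c::real_normed_vector \<Rightarrow>\<^sub>L real"
    and x x' :: "'a::real_normed_vector" and y y' :: "'b::real_normed_vector"
  assumes eq: "evaluation_functional x y \<phi> = evaluation_functional x' y' \<psi>"
    and nz: "x' \<noteq> 0" "y' \<noteq> 0" "\<psi> \<noteq> 0"
  shows "\<exists>c. x' = c *\<^sub>R x" and "\<exists>c. y' = c *\<^sub>R y"
proof -
  have tensor: "blinfun_apply f x * blinfun_apply g y * blinfun_apply \<phi> z
      = blinfun_apply f x' * blinfun_apply g y' * blinfun_apply \<psi> z" for f g z
    using arg_cong[OF eq, of "\<lambda>F. blinfun_apply F (rank_one_bilin f g z)"]
    by (simp add: evaluation_functional_apply rank_one_bilin_apply blinfun.scaleR_right)
  obtain z where z: "blinfun_apply \<psi> z \<noteq> 0"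
    using nz(3) by (metis blinfun_eqI blinfun.zero_left)
  obtain f0 where f0: "blinfun_apply f0 x' \<noteq> (0::real)"
    using nz(1) blinfun_real_separates by blast
  obtain g0 where g0: "blinfun_apply g0 y' \<noteq> (0::real)"
    using nz(2) blinfun_real_separates by blast
  let ?c = "blinfun_apply g0 y * blinfun_apply \<phi> z / (blinfun_apply g0 y' * blinfun_apply \<psi> z)"
  have "blinfun_apply f (x' - ?c *\<^sub>R x) = 0" for f :: "'a \<Rightarrow>\<^sub>L real"
    using tensor[of f g0 z] z g0
    by (simp add: blinfun.diff_right blinfun.scaleR_right field_simps)
  then have "x' - ?c *\<^sub>R x = 0"
    by (rule blinfun_real_separates)
  then show "\<exists>c. x' = c *\<^sub>R x"
    by (intro exI[of _ ?c]) simp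
  let ?d = "blinfun_apply f0 x * blinfun_apply \<phi> z / (blinfun_apply f0 x' * blinfun_apply \<psi> z)"
  have "blinfun_apply g (y' - ?d *\<^sub>R y) = 0" for g :: "'b \<Rightarrow>\<^sub>L real"
    using tensor[of f0 g z] z f0
    by (simp add: blinfun.diff_right blinfun.scaleR_right field_simps)
  then have "y' - ?d *\<^sub>R y = 0"
    by (rule blinfun_real_separates)
  then show "\<exists>c. y' = c *\<^sub>R y"
    by (intro exI[of _ ?d]) simp
qed

lemma unit_vectors_parallel:
  fixes x x' :: "'a::real_normed_vector"
  assumes "norm x = 1" "norm x' = 1" "x' = c *\<^sub>R x"
  shows "x' = x \<or> x' = - x"
proof -
  have "\<bar>c\<bar> = 1" using assms by simp
  then have "c = 1 \<or> c = - 1" by linarith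
  then show ?thesis using assms(3) by auto
qed


section \<open>Norm attainment at smooth points\<close>

theorem theorem3p3:
  fixes T :: "('a::real_normed_vector, 'b::real_normed_vector, 'c::real_normed_vector) bilin"
  assumes "dim_gt_one TYPE('a)" and "dim_gt_one TYPE('b)" and "dim_gt_one TYPE('c)"
    and "smooth_point T"
    and "norm_attainment_set T \<noteq> {}"
  shows "\<exists>x0\<in>sphere 0 1. \<exists>y0\<in>sphere 0 1.
    norm_attainment_set T = {(x0, y0), (x0, - y0), (- x0, y0), (- x0, - y0)}"
proof -
  have T: "norm T \<noteq> 0"
    using assms(4) by (simp add: smooth_point_def)
  obtain x0 y0 where x0: "norm x0 = 1" and y0: "norm y0 = 1"
    and att0: "norm (bilin_apply T x0 y0) = norm T"
    using assms(5) by (auto simp: norm_attainment_set_def)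
  obtain \<phi> where \<phi>: "norm \<phi> \<le> 1" "blinfun_apply \<phi> (bilin_apply T x0 y0) = norm T"
    using norming_functional_exists[of "bilin_apply T x0 y0"] att0 by metis
  have "(x = x0 \<or> x = - x0) \<and> (y = y0 \<or> y = - y0)"
    if "(x, y) \<in> norm_attainment_set T" for x y
  proof -
    from that have x: "norm x = 1" and y: "norm y = 1" and att: "norm (bilin_apply T x y) = norm T"
      by (auto simp: norm_attainment_set_def)
    obtain \<psi> where \<psi>: "norm \<psi> \<le> 1" "blinfun_apply \<psi> (bilin_apply T x y) = norm T"
      using norming_functional_exists[of "bilin_apply T x y"] att by metis
    have eq: "evaluation_functional x0 y0 \<phi> = evaluation_functional x y \<psi>"
      using assms(4) x0 y0 \<phi> x y \<psi> by (rule evaluation_functionals_eq_if_smooth)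
    have nz: "x \<noteq> 0" "y \<noteq> 0" "\<psi> \<noteq> 0"
      using x y \<psi>(2) T by auto
    obtain c d where "x = c *\<^sub>R x0" "y = d *\<^sub>R y0"
      using elementary_tensor_factors_parallel[OF eq nz] by blast
    then show ?thesis
      using unit_vectors_parallel[OF x0 x] unit_vectors_parallel[OF y0 y] by blast
  qed
  then have "norm_attainment_set T \<subseteq> {(x0, y0), (x0, - y0), (- x0, y0), (- x0, - y0)}"
    by auto
  moreover have "{(x0, y0), (x0, - y0), (- x0, y0), (- x0, - y0)} \<subseteq> norm_attainment_set T"
    using x0 y0 att0
    by (simp add: norm_attainment_set_def
        bounded_bilinear.minus_left[OF bounded_bilinear_bilin_apply]
        bounded_bilinear.minus_right[OF bounded_bilinear_bilin_apply])
  ultimately show ?thesis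
    using x0 y0 by (intro bexI[of _ x0] bexI[of _ y0]) auto
qed

end
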